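(* Let $k$ be a positive integer and let $w\in\mathbb{Z}/k\mathbb{Z}$ be an element of multiplicative order $c$, where $c\mid k$. Then the graph $G(k,c,w)$ is a central digraph; that is, for every $(p,i)$ and every $(q,j)$ in $\mathbb{Z}/k\mathbb{Z}\times\mathbb{Z}/k\mathbb{Z}$ there is a unique link from $(p,i)$ to $(q,j)$ in $G(k,c,w)$.
   Context: For a positive integer $k$ and an element $w$ of multiplicative order $c$ in $\mathbb{Z}/k\mathbb{Z}$ (so $w$ is a unit mod $k$) with $c\mid k$, the directed graph $G(k,c,w)$ (loops allowed) has vertex set $\mathbb{Z}/k\mathbb{Z}\times\mathbb{Z}/k\mathbb{Z}$, and its edges are all the directed edges $(p,i)\to(p+w^j i,\,j)$ with $p,i,j\in\mathbb{Z}/k\mathbb{Z}$. Here $w^j$ for $j\in\mathbb{Z}/k\mathbb{Z}$ is well defined because $c\mid k$. In a directed graph, a link from a vertex $x$ to a vertex $z$ (not necessarily distinct) is a vertex $y$ such that $x\to y$ and $y\to z$ are both edges. A central digraph is a directed graph in which for any vertices $x,z$ (not necessarily distinct) there is a unique link from $x$ to $z$; equivalently, the square of its adjacency matrix is the all-ones matrix. *)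

theory Defs
  imports "HOL-Number_Theory.Pocklington" "Graph_Theory.Pair_Digraph"
begin

text \<open>
  Loops are allowed, parallel edges are not, so a directed graph is a
  \<^typ>\<open>'a pair_pre_digraph\<close> whose edges join vertices (\<^locale>\<open>pair_wf_digraph\<close>).
\<close>

definition link :: "'a pair_pre_digraph \<Rightarrow> 'a \<Rightarrow> 'a \<Rightarrow> 'a \<Rightarrow> bool" where
  "link G x z y \<longleftrightarrow> y \<in> pverts G \<and> (x, y) \<in> parcs G \<and> (y, z) \<in> parcs G"

definition central_digraph :: "'a pair_pre_digraph \<Rightarrow> bool" where
  "central_digraph G \<longleftrightarrow>
     pair_wf_digraph G \<and> (\<forall>x \<in> pverts G. \<forall>z \<in> pverts G. \<exists>!y. link G x z y)"

text \<open>
  The residues modulo \<open>k\<close> are represented by \<open>{..<k}\<close>, which also covers \<open>k = 1\<close>. The power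
  \<open>w ^ j\<close> uses the representative \<open>j\<close> in this range; the choice is immaterial when the order
  of \<open>w\<close> divides \<open>k\<close>, see \<open>power_cong_exponent\<close> and \<open>residue_digraph_edge\<close> below.
  The order \<open>c\<close> is determined by \<open>k\<close> and \<open>w\<close>, and the edges do not depend on it.
\<close>

definition residue_digraph :: "nat \<Rightarrow> nat \<Rightarrow> nat \<Rightarrow> (nat \<times> nat) pair_pre_digraph" where
  "residue_digraph k c w =
     \<lparr> pverts = {..<k} \<times> {..<k},
       parcs = {((p, i), ((p + w ^ j * i) mod k, j)) | p i j. p < k \<and> i < k \<and> j < k} \<rparr>"

lemma power_cong_exponent:
  fixes k w j j' :: nat
  assumes "k > 0" "ord k w dvd k" "[j = j'] (mod k)"
  shows "[w ^ j = w ^ j'] (mod k)"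
proof -
  have "ord k w \<noteq> 0"
    using assms(1,2) by (metis dvd_0_left less_irrefl)
  then have "coprime k w"
    by (simp add: ord_eq_0)
  moreover have "[j = j'] (mod ord k w)"
    using assms(2,3) cong_dvd_modulus_nat by blast
  ultimately show ?thesis
    by (simp add: order_divides_expdiff)
qed

lemma residue_digraph_edge:
  fixes k w p i j :: nat
  assumes "k > 0" "ord k w dvd k"
  shows "((p mod k, i mod k), ((p + w ^ j * i) mod k, j mod k)) \<in> parcs (residue_digraph k c w)"
proof -
  have "[w ^ (j mod k) = w ^ j] (mod k)"
    using assms by (intro power_cong_exponent) (auto simp: cong_def)
  then have "[p mod k + w ^ (j mod k) * (i mod k) = p + w ^ j * i] (mod k)"
    by (intro cong_add cong_mult) (auto simp: cong_def)
  then have "(p + w ^ j * i) mod k = (p mod k + w ^ (j mod k) * (i mod k)) mod k"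
    by (simp add: cong_def)
  then show ?thesis
    using assms(1) unfolding residue_digraph_def by fastforce
qed

end

theory Submission
  imports Defs
begin

text \<open>
  A link from \<open>(p, i)\<close> to \<open>(q, j)\<close> must have the form \<open>(p + w\<^sup>y i, y)\<close>, and it then leads to
  \<open>(p + w\<^sup>y i + w\<^sup>j y, j)\<close>. So the graph is central exactly when every map
  \<open>y \<mapsto> i w\<^sup>y + w\<^sup>j y\<close> on the residues modulo \<open>k\<close> takes every value exactly once. These residues
  form a finite set, so injectivity of the map is enough.

  The exponential term is what obstructs injectivity, and it is removed by strong induction on
  the divisors of \<open>k\<close>. The value of \<open>w\<^sup>y\<close> modulo a divisor \<open>n > 1\<close> of \<open>k\<close> depends only on \<open>y\<close> modulo
  the order of \<open>w\<close> modulo \<open>n\<close>. This order is smaller than \<open>n\<close>, and it is again a divisor of \<open>k\<close>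
  because it divides the order of \<open>w\<close> modulo \<open>k\<close>, which divides \<open>k\<close>. If two arguments with the
  same image are already known to agree modulo this smaller divisor, then their exponential terms
  agree modulo \<open>n\<close>; what remains is linear with the invertible coefficient \<open>w\<^sup>j\<close>, so the arguments
  agree modulo \<open>n\<close>. The case \<open>n = k\<close> is the injectivity, stated in
  \<open>exponential_plus_linear_inj_mod\<close>.
\<close>

lemma ord_dvd_ord_of_dvd_modulus:
  fixes m n w :: nat
  assumes "m dvd n"
  shows "ord m w dvd ord n w"
proof -
  have "[w ^ ord n w = 1] (mod m)"
    using ord_works[of w n] assms by (blast intro: cong_dvd_modulus_nat)
  then show ?thesis
    by (simp only: ord_divides)
qed

lemma ord_less_modulus:
  fixes n w :: nat
  assumes "n > 1" "coprime n w"
  shows "ord n w < n"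
proof -
  have "ord n w \<le> totient n"
    using assms order_divides_totient[of n w] by (intro dvd_imp_le) auto
  also have "\<dots> < n"
    using assms(1) by (rule totient_less)
  finally show ?thesis .
qed

text \<open>
  The induction needs the congruence of the arguments modulo every divisor \<open>n\<close> of \<open>k\<close>, not only
  modulo \<open>k\<close>, because the claim for \<open>n\<close> is reduced to the claim for the order of \<open>w\<close> modulo \<open>n\<close>.
\<close>

lemma exponential_plus_linear_inj_mod:
  fixes k w u a y z :: nat
  assumes "k > 0" "ord k w dvd k" "coprime u k"
    and eq: "[a * w ^ y + u * y = a * w ^ z + u * z] (mod k)"
  shows "[y = z] (mod k)"
proof -
  have "ord k w \<noteq> 0"
    using assms(1,2) by (metis dvd_0_left less_irrefl)
  then have cop: "coprime k w"
    by (simp add: ord_eq_0)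
  have "[y = z] (mod n)" if "n dvd k" for n
    using that
  proof (induction n rule: less_induct)
    case (less n)
    have "n > 0"
      using less.prems assms(1) by (rule dvd_pos_nat[rotated])
    show ?case
    proof (cases "n = 1")
      case True
      then show ?thesis by simp
    next
      case False
      have copn: "coprime n w"
        using coprime_divisors[OF less.prems dvd_refl cop] .
      have "ord n w < n"
        using ord_less_modulus copn False \<open>n > 0\<close> by simp
      moreover have "ord n w dvd k"
        using ord_dvd_ord_of_dvd_modulus[OF less.prems] assms(2) by (rule dvd_trans)
      ultimately have "[y = z] (mod ord n w)"
        by (rule less.IH)
      then have "[w ^ y = w ^ z] (mod n)"
        using copn by (simp add: order_divides_expdiff)
      then have "[a * w ^ y + u * z = a * w ^ z + u * z] (mod n)"
        by (intro cong_add cong_mult cong_refl)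
      moreover have "[a * w ^ y + u * y = a * w ^ z + u * z] (mod n)"
        using eq less.prems by (rule cong_dvd_modulus_nat)
      ultimately have "[a * w ^ y + u * y = a * w ^ y + u * z] (mod n)"
        by (metis cong_def)
      then have "[u * y = u * z] (mod n)"
        by (simp add: cong_add_lcancel_nat)
      moreover have "coprime u n"
        using coprime_divisors[OF dvd_refl less.prems assms(3)] .
      ultimately show ?thesis
        by (simp add: cong_mult_lcancel_nat)
    qed
  qed
  then show ?thesis by simp
qed

lemma exponential_plus_linear_bij_mod:
  fixes k w u a p :: nat
  assumes "k > 0" "ord k w dvd k" "coprime u k"
  shows "bij_betw (\<lambda>y. (p + a * w ^ y + u * y) mod k) {..<k} {..<k}"
proof -
  let ?f = "\<lambda>y. (p + a * w ^ y + u * y) mod k"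
  have "inj_on ?f {..<k}"
  proof (rule inj_onI)
    fix y z
    assume y: "y \<in> {..<k}" and z: "z \<in> {..<k}" and "?f y = ?f z"
    then have "[p + (a * w ^ y + u * y) = p + (a * w ^ z + u * z)] (mod k)"
      by (simp add: cong_def add.assoc)
    then have "[a * w ^ y + u * y = a * w ^ z + u * z] (mod k)"
      by (simp only: cong_add_lcancel_nat)
    then have "[y = z] (mod k)"
      by (rule exponential_plus_linear_inj_mod[OF assms])
    then show "y = z"
      using y z by (simp add: cong_def)
  qed
  moreover have "?f ` {..<k} \<subseteq> {..<k}"
    using assms(1) by auto
  ultimately show ?thesis
    by (simp add: bij_betw_def endo_inj_surj)
qed

lemma link_residue_digraph_iff:
  fixes k c w p i q j :: nat
  assumes "p < k" "i < k" "j < k"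
  shows "link (residue_digraph k c w) (p, i) (q, j) v \<longleftrightarrow>
    (\<exists>y<k. v = ((p + w ^ y * i) mod k, y) \<and> q = (p + i * w ^ y + w ^ j * y) mod k)"
proof -
  have "((p + w ^ y * i) mod k + w ^ j * y) mod k = (p + i * w ^ y + w ^ j * y) mod k" for y
    by (simp add: mod_add_left_eq mult.commute)
  then show ?thesis
    using assms by (auto simp: link_def residue_digraph_def)
qed

theorem theorem2:
  fixes k c w :: nat
  assumes "k > 0" and "w < k" and "ord k w = c" and "c dvd k"
  shows "central_digraph (residue_digraph k c w)"
proof -
  have ord_dvd: "ord k w dvd k"
    using assms(3,4) by simp
  then have "ord k w \<noteq> 0"
    using assms(1) by (metis dvd_0_left less_irrefl)
  then have cop: "coprime (w ^ j) k" for j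
    by (simp add: ord_eq_0 coprime_commute)
  have "pair_wf_digraph (residue_digraph k c w)"
    using assms(1) by unfold_locales (auto simp: residue_digraph_def)
  moreover have "\<exists>!v. link (residue_digraph k c w) (p, i) (q, j) v"
    if "p < k" "i < k" "q < k" "j < k" for p i q j
  proof -
    have "bij_betw (\<lambda>y. (p + i * w ^ y + w ^ j * y) mod k) {..<k} {..<k}"
      using assms(1) ord_dvd cop by (rule exponential_plus_linear_bij_mod)
    then have inj: "inj_on (\<lambda>y. (p + i * w ^ y + w ^ j * y) mod k) {..<k}"
      and surj: "q \<in> (\<lambda>y. (p + i * w ^ y + w ^ j * y) mod k) ` {..<k}"
      using that(3) by (auto simp: bij_betw_def)
    obtain y where y: "y < k" "q = (p + i * w ^ y + w ^ j * y) mod k"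
      using surj by auto
    have "y' = y" if "y' < k" "q = (p + i * w ^ y' + w ^ j * y') mod k" for y'
      using inj_onD[OF inj, of y' y] that y by simp
    with y have "\<exists>!y. y < k \<and> q = (p + i * w ^ y + w ^ j * y) mod k"
      by blast
    then show ?thesis
      unfolding link_residue_digraph_iff[OF that(1,2,4)] by blast
  qed
  ultimately show ?thesis
    unfolding central_digraph_def by (auto simp: residue_digraph_def)
qed

end
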